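(* Let $s, t \ge 3$ be integers and let $m, n \ge 1$ be integers. Given any $(3,s+1;m)$-graph $G$ and any $(3,t+1;n)$-graph $H$, one can construct from $G$ and $H$ a $(3,s+t;m+n-2)$-graph $F$; in particular, if a $(3,s+1;m)$-graph and a $(3,t+1;n)$-graph exist, then a $(3,s+t;m+n-2)$-graph exists.
   Context: All graphs are finite, simple and undirected. A $(3,k;n)$-graph is a triangle-free graph on exactly $n$ vertices with no independent set of $k$ vertices (i.e. its independence number is less than $k$). *)

theory Defs
  imports "HOL-Library.Ramsey"
begin

definition simple_graph :: "'a set \<Rightarrow> 'a set set \<Rightarrow> bool"
  where "simple_graph V E \<longleftrightarrow> finite V \<and> E \<subseteq> [V]\<^bsup>2\<^esup>"

definition triangle_free :: "'a set \<Rightarrow> 'a set set \<Rightarrow> bool"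
  where "triangle_free V E \<longleftrightarrow> \<not> (\<exists>T \<in> [V]\<^bsup>3\<^esup>. clique T E)"

text \<open>
  A \<open>(3,k;n)\<close>-graph with vertex set \<open>V\<close> and edge set \<open>E\<close>. The null graph is allowed,
  since \<open>n\<close> may be \<open>0\<close>.
\<close>
definition ramsey3_graph :: "nat \<Rightarrow> nat \<Rightarrow> 'a set \<Rightarrow> 'a set set \<Rightarrow> bool"
  where "ramsey3_graph k n V E \<longleftrightarrow>
    simple_graph V E \<and> card V = n \<and> triangle_free V E \<and> \<not> (\<exists>I \<in> [V]\<^bsup>k\<^esup>. indep I E)"

text \<open>Every finite graph is isomorphic to one whose vertices are natural numbers.\<close>
definition ramsey3_graph_exists :: "nat \<Rightarrow> nat \<Rightarrow> bool"
  where "ramsey3_graph_exists k n \<longleftrightarrow> (\<exists>(V :: nat set) E. ramsey3_graph k n V E)"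

end

theory Submission
  imports Defs "HOL-Library.Countable"
begin

text \<open>
  Choose vertices \<open>u\<close> of \<open>G\<close> and \<open>v\<close> of \<open>H\<close>. Let \<open>F\<close> be the disjoint union of \<open>G - u\<close> and
  \<open>H - v\<close> with all edges between the neighbourhoods \<open>N(u)\<close> and \<open>N(v)\<close> added. Both neighbourhoods
  are independent, so no triangle arises. An independent set of \<open>F\<close> misses \<open>N(u)\<close> or \<open>N(v)\<close>;
  if it misses \<open>N(u)\<close>, its part in \<open>G\<close> stays independent after adding \<open>u\<close> and so has at most
  \<open>s - 1\<close> elements, while its part in \<open>H\<close> has at most \<open>t\<close>.
\<close>

text \<open>Edges of a simple graph are two-element sets, so three mutual edges already force
  \<open>a\<close>, \<open>b\<close>, \<open>c\<close> to be distinct. The form without distinctness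
  or membership conditions suits case analysis on single vertices.\<close>

lemma triangle_free_iff:
  assumes "simple_graph V E"
  shows "triangle_free V E \<longleftrightarrow> (\<forall>a b c. {a,b} \<in> E \<longrightarrow> {b,c} \<in> E \<longrightarrow> {a,c} \<in> E \<longrightarrow> False)"
proof -
  have edge: "a \<in> V \<and> b \<in> V \<and> a \<noteq> b" if "{a,b} \<in> E" for a b
    using that assms doubleton_in_nsets_2[of a b V] by (auto simp only: simple_graph_def)
  show ?thesis
  proof
    assume tf: "triangle_free V E"
    show "\<forall>a b c. {a,b} \<in> E \<longrightarrow> {b,c} \<in> E \<longrightarrow> {a,c} \<in> E \<longrightarrow> False"
    proof (intro allI impI)
      fix a b c assume e: "{a,b} \<in> E" "{b,c} \<in> E" "{a,c} \<in> E"
      have "{a,b,c} \<in> [V]\<^bsup>3\<^esup>"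
        using edge[OF e(1)] edge[OF e(2)] edge[OF e(3)] by (auto simp: nsets_def)
      moreover have "clique {a,b,c} E"
        using e by (auto simp: clique_def insert_commute)
      ultimately show False
        using tf by (auto simp: triangle_free_def)
    qed
  next
    assume no: "\<forall>a b c. {a,b} \<in> E \<longrightarrow> {b,c} \<in> E \<longrightarrow> {a,c} \<in> E \<longrightarrow> False"
    show "triangle_free V E"
      unfolding triangle_free_def
    proof
      assume "\<exists>T\<in>[V]\<^bsup>3\<^esup>. clique T E"
      then obtain T where T: "card T = 3" "clique T E"
        by (auto simp: nsets_def)
      then obtain a b c where "T = {a,b,c}" "a \<noteq> b" "a \<noteq> c" "b \<noteq> c"
        by (auto simp: card_3_iff)
      with T no show False
        by (auto simp: clique_def)
    qed
  qed
qed

text \<open>Independence passes to subsets, so an independent set with at least \<open>k\<close>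
  elements can be shrunk to one with exactly \<open>k\<close>. The bound on cardinalities is the
  form that counting arguments can use.\<close>

lemma indep_free_iff_card_less:
  assumes "finite V"
  shows "\<not> (\<exists>I \<in> [V]\<^bsup>k\<^esup>. indep I E) \<longleftrightarrow> (\<forall>I. I \<subseteq> V \<longrightarrow> indep I E \<longrightarrow> card I < k)"
proof
  assume no: "\<not> (\<exists>I \<in> [V]\<^bsup>k\<^esup>. indep I E)"
  show "\<forall>I. I \<subseteq> V \<longrightarrow> indep I E \<longrightarrow> card I < k"
  proof (intro allI impI, rule ccontr)
    fix I assume I: "I \<subseteq> V" "indep I E" "\<not> card I < k"
    then obtain J where J: "J \<subseteq> I" "card J = k" "finite J"
      by (meson obtain_subset_with_card_n not_less)
    then have "J \<in> [V]\<^bsup>k\<^esup>" "indep J E"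
      using I by (auto simp: nsets_def indep_def)
    with no show False by blast
  qed
qed (auto simp: nsets_def)

text \<open>Serves to move a graph on a sum type to the natural numbers. Injectivity makes
  \<open>f\<close> an isomorphism onto the image, so triangles and independent sets pull back with
  their sizes.\<close>

lemma ramsey3_graph_image:
  assumes G: "ramsey3_graph k n V E" and inj: "inj f"
  shows "ramsey3_graph k n (f ` V) ((`) f ` E)"
proof -
  have sg: "simple_graph V E" and fin: "finite V"
    using G by (auto simp: ramsey3_graph_def simple_graph_def)
  have edge: "{f a, f b} \<in> (`) f ` E \<longleftrightarrow> {a,b} \<in> E" for a b
    using inj_image_eq_iff[OF inj, of "{a,b}"] by (auto simp: image_iff)
  have sg': "simple_graph (f ` V) ((`) f ` E)"
    using sg inj unfolding simple_graph_def nsets_def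
    by (auto simp: card_image inj_on_subset[OF inj])
  have "triangle_free (f ` V) ((`) f ` E)"
    unfolding triangle_free_iff[OF sg']
  proof (intro allI impI)
    fix x y z
    assume xyz: "{x,y} \<in> (`) f ` E" "{y,z} \<in> (`) f ` E" "{x,z} \<in> (`) f ` E"
    then obtain a b c where "x = f a" "y = f b" "z = f c"
      by (metis (no_types, lifting) imageE insertCI)
    with xyz show False
      using G triangle_free_iff[OF sg] by (auto simp: edge ramsey3_graph_def)
  qed
  moreover have "card J < k" if "J \<subseteq> f ` V" "indep J ((`) f ` E)" for J
  proof -
    obtain I where I: "I \<subseteq> V" "J = f ` I"
      using \<open>J \<subseteq> f ` V\<close> by (auto simp: subset_image_iff)
    have "indep I E"
      using that(2) inj by (auto simp: I indep_def edge inj_eq)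
    then show ?thesis
      using G I indep_free_iff_card_less[OF fin] card_image[OF inj_on_subset[OF inj]]
      by (auto simp: ramsey3_graph_def)
  qed
  ultimately show ?thesis
    using G sg' fin inj indep_free_iff_card_less[of "f ` V"]
    by (auto simp: ramsey3_graph_def card_image inj_on_subset[OF inj])
qed

lemma indep_insert_iff:
  "indep (insert u I) E \<longleftrightarrow> indep I E \<and> (\<forall>x\<in>I. x \<noteq> u \<longrightarrow> {x,u} \<notin> E)"
  by (auto simp: indep_def insert_commute)

lemma ramsey3_graph_join_neighbourhoods:
  fixes VG :: "'a set" and VH :: "'b set"
  assumes G: "ramsey3_graph (s + 1) m VG EG" and H: "ramsey3_graph (t + 1) n VH EH"
    and "m \<ge> 1" "n \<ge> 1"
  shows "\<exists>(VF :: ('a + 'b) set) EF. ramsey3_graph (s + t) (m + n - 2) VF EF"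
proof -
  have sG: "simple_graph VG EG" and fG: "finite VG" and cG: "card VG = m"
    and sH: "simple_graph VH EH" and fH: "finite VH" and cH: "card VH = n"
    using G H by (auto simp: ramsey3_graph_def simple_graph_def)
  \<comment> \<open>The bounds \<open>m \<ge> 1\<close> and \<open>n \<ge> 1\<close> provide the
    vertices to delete.\<close>
  obtain u v where u: "u \<in> VG" and v: "v \<in> VH"
    using cG cH \<open>m \<ge> 1\<close> \<open>n \<ge> 1\<close> by (metis card.empty ex_in_conv not_one_le_zero)
  have tG: "{a,b} \<in> EG \<Longrightarrow> {b,c} \<in> EG \<Longrightarrow> {a,c} \<in> EG \<Longrightarrow> False" for a b c
    using G triangle_free_iff[OF sG] by (auto simp: ramsey3_graph_def)
  have tH: "{a,b} \<in> EH \<Longrightarrow> {b,c} \<in> EH \<Longrightarrow> {a,c} \<in> EH \<Longrightarrow> False" for a b c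
    using H triangle_free_iff[OF sH] by (auto simp: ramsey3_graph_def)
  have iG: "card I < s + 1" if "I \<subseteq> VG" "indep I EG" for I
    using G indep_free_iff_card_less[OF fG] that by (auto simp: ramsey3_graph_def)
  have iH: "card I < t + 1" if "I \<subseteq> VH" "indep I EH" for I
    using H indep_free_iff_card_less[OF fH] that by (auto simp: ramsey3_graph_def)
  define VF where "VF = (VG - {u}) <+> (VH - {v})"
  \<comment> \<open>Both mixed cases are listed so that the relation on ordered pairs is symmetric,
    which makes membership of \<open>{p,q}\<close> in \<open>EF\<close> independent of the order of
    \<open>p\<close> and \<open>q\<close>.\<close>
  define adj where "adj p q \<longleftrightarrow>
    (case (p, q) of
       (Inl a, Inl b) \<Rightarrow> {a,b} \<in> EG
     | (Inr a, Inr b) \<Rightarrow> {a,b} \<in> EH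
     | (Inl a, Inr b) \<Rightarrow> {a,u} \<in> EG \<and> {b,v} \<in> EH
     | (Inr b, Inl a) \<Rightarrow> {a,u} \<in> EG \<and> {b,v} \<in> EH)" for p q
  define EF where "EF = {{p,q} | p q. p \<in> VF \<and> q \<in> VF \<and> p \<noteq> q \<and> adj p q}"
  have adj_simps:
    "adj (Inl a) (Inl a') \<longleftrightarrow> {a,a'} \<in> EG"
    "adj (Inr b) (Inr b') \<longleftrightarrow> {b,b'} \<in> EH"
    "adj (Inl a) (Inr b) \<longleftrightarrow> {a,u} \<in> EG \<and> {b,v} \<in> EH"
    "adj (Inr b) (Inl a) \<longleftrightarrow> {a,u} \<in> EG \<and> {b,v} \<in> EH" for a a' b b'
    by (auto simp: adj_def)
  have adj_sym: "adj p q \<longleftrightarrow> adj q p" for p q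
    by (cases p; cases q) (auto simp: adj_simps insert_commute)
  have edge: "{p,q} \<in> EF \<longleftrightarrow> p \<in> VF \<and> q \<in> VF \<and> p \<noteq> q \<and> adj p q" for p q
    using adj_sym by (auto simp: EF_def doubleton_eq_iff)
  have fF: "finite VF"
    using fG fH by (simp add: VF_def)
  have sF: "simple_graph VF EF"
    using fF by (auto simp: simple_graph_def EF_def nsets_def)
  \<comment> \<open>Truncated subtraction is harmless: both sets are nonempty, so (m - 1) + (n - 1)
    = m + n - 2.\<close>
  have cF: "card VF = m + n - 2"
    using fG fH u v cG cH \<open>m \<ge> 1\<close> \<open>n \<ge> 1\<close> by (simp add: VF_def card_Plus)
  have "triangle_free VF EF"
    unfolding triangle_free_iff[OF sF]
  proof (intro allI impI)
    fix p q r
    assume "{p,q} \<in> EF" "{q,r} \<in> EF" "{p,r} \<in> EF"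
    then have "adj p q" "adj q r" "adj p r"
      by (auto simp: edge)
    \<comment> \<open>Three vertices on one side form a triangle of G or H. Otherwise two adjacent
      vertices lie on one side, both joined to the third; they are then both neighbours of
      \<open>u\<close> (or of \<open>v\<close>) and form a triangle with it.\<close>
    then show False
      by (cases p; cases q; cases r)
        (auto simp: adj_simps insert_commute dest: tG tH)
  qed
  moreover have "card I < s + t" if I: "I \<subseteq> VF" "indep I EF" for I
  proof -
    define A where "A = Inl -` I"
    define B where "B = Inr -` I"
    have sub: "A \<subseteq> VG - {u}" "B \<subseteq> VH - {v}"
      using I(1) by (auto simp: A_def B_def VF_def)
    have fin: "finite A" "finite B"
      using sub fG fH by (meson finite_Diff finite_subset)+
    have "I = A <+> B"
      by (auto simp: A_def B_def Plus_def image_iff) (metis sum.exhaust)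
    then have card: "card I = card A + card B"
      using fin by (simp add: card_Plus)
    have nadj: "\<not> adj p q" if "p \<in> I" "q \<in> I" "p \<noteq> q" for p q
      using I that edge[of p q] by (auto simp: indep_def)
    have indA: "indep A EG"
      unfolding indep_def using nadj[of "Inl _" "Inl _"] by (auto simp: A_def adj_simps)
    have indB: "indep B EH"
      unfolding indep_def using nadj[of "Inr _" "Inr _"] by (auto simp: B_def adj_simps)
    \<comment> \<open>A neighbour of \<open>u\<close> in \<open>A\<close> and a neighbour of
      \<open>v\<close> in \<open>B\<close> would be joined in \<open>F\<close>, although both come
      from \<open>I\<close>.\<close>
    have "(\<forall>a\<in>A. {a,u} \<notin> EG) \<or> (\<forall>b\<in>B. {b,v} \<notin> EH)"
      using nadj[of "Inl _" "Inr _"] by (auto simp: A_def B_def adj_simps)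
    then show ?thesis
    proof
      assume "\<forall>a\<in>A. {a,u} \<notin> EG"
      then have "card (insert u A) < s + 1"
        using sub u indA by (intro iG) (auto simp: indep_insert_iff)
      moreover have "card B < t + 1"
        using sub indB by (intro iH) auto
      \<comment> \<open>Since \<open>u\<close> was deleted, it is not in \<open>A\<close>; this
        extra element lowers the bound on \<open>card A\<close> from s to s - 1 and makes the sum
        strictly less than s + t.\<close>
      moreover have "card (insert u A) = card A + 1"
        using sub fin by (subst card_insert_disjoint) auto
      ultimately show ?thesis
        using card by simp
    next
      assume "\<forall>b\<in>B. {b,v} \<notin> EH"
      then have "card (insert v B) < t + 1"
        using sub v indB by (intro iH) (auto simp: indep_insert_iff)
      moreover have "card A < s + 1"
        using sub indA by (intro iG) auto
      moreover have "card (insert v B) = card B + 1"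
        using sub fin by (subst card_insert_disjoint) auto
      ultimately show ?thesis
        using card by simp
    qed
  qed
  ultimately have "ramsey3_graph (s + t) (m + n - 2) VF EF"
    using sF cF indep_free_iff_card_less[OF fF] by (auto simp: ramsey3_graph_def)
  then show ?thesis by blast
qed

theorem mainTheorem3:
  fixes s t m n :: nat
  assumes "s \<ge> 3" and "t \<ge> 3" and "m \<ge> 1" and "n \<ge> 1"
  shows "(\<forall>(VG :: 'a set) EG (VH :: 'b set) EH.
            ramsey3_graph (s + 1) m VG EG \<longrightarrow> ramsey3_graph (t + 1) n VH EH \<longrightarrow>
            (\<exists>(VF :: ('a + 'b) set) EF. ramsey3_graph (s + t) (m + n - 2) VF EF))
       \<and> (ramsey3_graph_exists (s + 1) m \<longrightarrow> ramsey3_graph_exists (t + 1) n \<longrightarrow>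
            ramsey3_graph_exists (s + t) (m + n - 2))"
proof (intro conjI allI impI)
  fix VG :: "'a set" and EG and VH :: "'b set" and EH
  assume "ramsey3_graph (s + 1) m VG EG" "ramsey3_graph (t + 1) n VH EH"
  then show "\<exists>(VF :: ('a + 'b) set) EF. ramsey3_graph (s + t) (m + n - 2) VF EF"
    using assms(3,4) by (rule ramsey3_graph_join_neighbourhoods)
next
  assume "ramsey3_graph_exists (s + 1) m" "ramsey3_graph_exists (t + 1) n"
  then obtain VF :: "(nat + nat) set" and EF where "ramsey3_graph (s + t) (m + n - 2) VF EF"
    using ramsey3_graph_join_neighbourhoods[OF _ _ assms(3,4)]
    unfolding ramsey3_graph_exists_def by metis
  \<comment> \<open>The construction yields vertices of type \<open>nat + nat\<close>, which is
    countable, so \<open>to_nat\<close> is an injective relabelling.\<close>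
  then have "ramsey3_graph (s + t) (m + n - 2) (to_nat ` VF) ((`) to_nat ` EF)"
    by (rule ramsey3_graph_image) simp
  then show "ramsey3_graph_exists (s + t) (m + n - 2)"
    unfolding ramsey3_graph_exists_def by blast
qed

end
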